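(* Let the cooperation decisions $q_{f,l,m}\in\{0,1\}$ be fixed. Consider the non-convex beamforming problem R0($\mathbf{w}_{\boldsymbol\rho}$): minimize $\sum_{\boldsymbol\rho\in\mathcal S}\mathsf{tr}(\mathbf w_{\boldsymbol\rho}\mathbf w_{\boldsymbol\rho}^H)$ over vectors $\mathbf w_{\boldsymbol\rho}\in\mathbb C^{MN_t}$, $\boldsymbol\rho\in\mathcal S$, subject to (C4) $\mathsf{tr}(\boldsymbol\Lambda_m\mathbf w_{\boldsymbol\rho}\mathbf w_{\boldsymbol\rho}^H)\le q_{f,l,m}P_m^{\max}$ for all $m\in\mathcal M$ and $\boldsymbol\rho=(k,f,l)\in\mathcal S$; (C5) $\mathsf{tr}\big(\sum_{\boldsymbol\rho\in\mathcal S}\boldsymbol\Lambda_m\mathbf w_{\boldsymbol\rho}\mathbf w_{\boldsymbol\rho}^H\big)\le P_m^{\max}$ for all $m\in\mathcal M$; (C6) $R_{\boldsymbol\rho}\ge R^{\mathrm{req}}_{\boldsymbol\rho}$ for all $\boldsymbol\rho\in\mathcal S$; (C7) $R_{\mathrm e,\boldsymbol\rho}\le R^{\mathrm{tol}}_{\mathrm e,\boldsymbol\rho}$ for all $\boldsymbol\rho\in\mathcal S$. Consider also the semidefinite program R1: minimize $\mathsf{tr}\big(\sum_{\boldsymbol\rho\in\mathcal S}\mathbf W_{\boldsymbol\rho}\big)$ over Hermitian matrices $\mathbf W_{\boldsymbol\rho}\in\mathbb C^{MN_t\times MN_t}$, $\boldsymbol\rho\in\mathcal S$, subject to ($\overline{\mathrm{C4}}$)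 $\mathsf{tr}(\boldsymbol\Lambda_m\mathbf W_{\boldsymbol\rho})\le q_{f,l,m}P_m^{\max}$ for all $m\in\mathcal M$ and $\boldsymbol\rho=(k,f,l)\in\mathcal S$; ($\overline{\mathrm{C5}}$) $\mathsf{tr}\big(\sum_{\boldsymbol\rho\in\mathcal S}\boldsymbol\Lambda_m\mathbf W_{\boldsymbol\rho}\big)\le P_m^{\max}$ for all $m\in\mathcal M$; ($\overline{\mathrm{C6}}$) $\frac{1}{\kappa^{\mathrm{req}}_{\boldsymbol\rho}}\mathsf{tr}(\mathbf W_{\boldsymbol\rho}\mathbf H_{\boldsymbol\rho})\ge\sigma^2+\sum_{\boldsymbol\rho'\in\mathcal S,\,\boldsymbol\rho'\ne\boldsymbol\rho}\mathsf{tr}(\mathbf W_{\boldsymbol\rho'}\mathbf H_{\boldsymbol\rho})$ for all $\boldsymbol\rho\in\mathcal S$; ($\overline{\mathrm{C7}}$) $\mathbf G^H\mathbf W_{\boldsymbol\rho}\mathbf G\preceq\sigma_{\mathrm e}^2\kappa^{\mathrm{tol}}_{\boldsymbol\rho}\mathbf I_{N_e}$ for all $\boldsymbol\rho\in\mathcal S$; ($\overline{\mathrm{C8}}$) $\mathbf W_{\boldsymbol\rho}\succeq\mathbf 0$ for all $\boldsymbol\rho\in\mathcal S$. Then R0($\mathbf w_{\boldsymbol\rho}$) and R1 have the same optimal value. In particular, an optimal solution $(\mathbf W^*_{\boldsymbol\rho})_{\boldsymbol\rho\in\mathcal S}$ of R1 satisfies $\mathsf{rank}(\mathbf W^*_{\boldsymbol\rho})\le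 1$ for every $\boldsymbol\rho\in\mathcal S$, and an optimal solution of R0($\mathbf w_{\boldsymbol\rho}$) is given by taking $\mathbf w^*_{\boldsymbol\rho}$ to be the principal eigenvector of $\mathbf W^*_{\boldsymbol\rho}$, scaled so that $\mathbf w^*_{\boldsymbol\rho}(\mathbf w^*_{\boldsymbol\rho})^H=\mathbf W^*_{\boldsymbol\rho}$.
   Context: Finite index sets: base stations $\mathcal M=\{1,\dots,M\}$, receivers $\mathcal K=\{1,\dots,K\}$, files $\mathcal F=\{1,\dots,F\}$, subfile indices $\mathcal L=\{1,\dots,L\}$. The set of requests is $\mathcal S\subseteq\mathcal K\times\mathcal F\times\mathcal L$; a request is written $\boldsymbol\rho=(k,f,l)$. Each base station has $N_t$ antennas and the eavesdropper has $N_e$ antennas. Given data: $P_m^{\max}\ge 0$; $\sigma^2>0$, $\sigma_{\mathrm e}^2>0$; $R^{\mathrm{req}}_{\boldsymbol\rho}>0$ and $R^{\mathrm{tol}}_{\mathrm e,\boldsymbol\rho}\ge0$; channels $\mathbf h_{\boldsymbol\rho}\in\mathbb C^{MN_t}$ and $\mathbf G\in\mathbb C^{MN_t\times N_e}$. $\boldsymbol\Lambda_m$ is the $MN_t\times MN_t$ diagonal matrix with ones in diagonal positions $(m-1)N_t+1,\dots,mN_t$ and zeros elsewhere, so that $\mathsf{tr}(\boldsymbol\Lambda_m\mathbf w\mathbf w^H)$ is the squared norm of the $m$-th length-$N_t$ block of $\mathbf w$. Rates (logarithms are base 2): $$R_{\boldsymbol\rho}=\log(1+\Gamma_{\boldsymbol\rho}),\qquad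 \Gamma_{\boldsymbol\rho}=\frac{\frac1{\sigma^2}|\mathbf h_{\boldsymbol\rho}^H\mathbf w_{\boldsymbol\rho}|^2}{1+\frac1{\sigma^2}\sum_{\boldsymbol\rho'\in\mathcal S,\boldsymbol\rho'\ne\boldsymbol\rho}|\mathbf h_{\boldsymbol\rho}^H\mathbf w_{\boldsymbol\rho'}|^2},$$ $$R_{\mathrm e,\boldsymbol\rho}=\log\det\Big(\mathbf I_{N_e}+\tfrac1{\sigma_{\mathrm e}^2}\mathbf G^H\mathbf w_{\boldsymbol\rho}\mathbf w_{\boldsymbol\rho}^H\mathbf G\Big).$$ Further notation: $\mathbf H_{\boldsymbol\rho}=\mathbf h_{\boldsymbol\rho}\mathbf h_{\boldsymbol\rho}^H$, $\kappa^{\mathrm{req}}_{\boldsymbol\rho}=2^{R^{\mathrm{req}}_{\boldsymbol\rho}}-1$, $\kappa^{\mathrm{tol}}_{\boldsymbol\rho}=2^{R^{\mathrm{tol}}_{\mathrm e,\boldsymbol\rho}}-1$. The optimal value of an infeasible minimization problem is $+\infty$. *)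

theory Defs
  imports
    "HOL-Library.Extended_Real"
    "Jordan_Normal_Form.Char_Poly"
    "Jordan_Normal_Form.Schur_Decomposition"
    "Jordan_Normal_Form.DL_Rank"
begin

definition tr :: "complex mat \<Rightarrow> complex" where
  "tr A = (\<Sum>i<dim_row A. A $$ (i, i))"

definition outer :: "complex vec \<Rightarrow> complex mat" where
  "outer w = mat (dim_vec w) (dim_vec w) (\<lambda>(i, j). w $ i * cnj (w $ j))"

definition mat_sum :: "nat \<Rightarrow> ('a \<Rightarrow> complex mat) \<Rightarrow> 'a set \<Rightarrow> complex mat" where
  "mat_sum n A I = mat n n (\<lambda>(i, j). \<Sum>x\<in>I. A x $$ (i, j))"

definition hermitian :: "nat \<Rightarrow> complex mat \<Rightarrow> bool" where
  "hermitian n A \<longleftrightarrow> A \<in> carrier_mat n n \<and> mat_adjoint A = A"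

(* (A v) \<bullet>c v is v^H A v, since \<bullet>c conjugates its second argument. *)
definition psd :: "nat \<Rightarrow> complex mat \<Rightarrow> bool" where
  "psd n A \<longleftrightarrow> hermitian n A \<and> (\<forall>v\<in>carrier_vec n. 0 \<le> Re ((A *\<^sub>v v) \<bullet>c v))"

definition loewner_le :: "nat \<Rightarrow> complex mat \<Rightarrow> complex mat \<Rightarrow> bool" where
  "loewner_le n A B \<longleftrightarrow> A \<in> carrier_mat n n \<and> B \<in> carrier_mat n n \<and> psd n (B - A)"

(* Used for Hermitian A only, whose eigenvalues are real. *)
definition principal_eigenvector :: "complex mat \<Rightarrow> complex vec \<Rightarrow> bool" where
  "principal_eigenvector A v \<longleftrightarrow>
     (\<exists>k. eigenvector A v k \<and> (\<forall>\<mu>. eigenvalue A \<mu> \<longrightarrow> Re \<mu> \<le> Re k))"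

definition optimal_value :: "('x \<Rightarrow> bool) \<Rightarrow> ('x \<Rightarrow> real) \<Rightarrow> ereal" where
  "optimal_value feasible obj = (INF x\<in>{x. feasible x}. ereal (obj x))"

definition optimal_solution :: "('x \<Rightarrow> bool) \<Rightarrow> ('x \<Rightarrow> real) \<Rightarrow> 'x \<Rightarrow> bool" where
  "optimal_solution feasible obj x \<longleftrightarrow>
     feasible x \<and> (\<forall>y. feasible y \<longrightarrow> obj x \<le> obj y)"

type_synonym request = "nat \<times> nat \<times> nat"

(* noise and noise_eve are the variances sigma^2 and sigma_e^2. *)
record network =
  num_bs :: nat
  num_rx :: nat
  num_files :: nat
  num_subfiles :: nat
  num_tx_ant :: nat
  num_eve_ant :: nat
  requests :: "request set"
  power_max :: "nat \<Rightarrow> real"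
  noise :: real
  noise_eve :: real
  rate_req :: "request \<Rightarrow> real"
  rate_tol :: "request \<Rightarrow> real"
  chan :: "request \<Rightarrow> complex vec"
  chan_eve :: "complex mat"

definition tx_dim :: "network \<Rightarrow> nat" where
  "tx_dim N = num_bs N * num_tx_ant N"

definition valid_network :: "network \<Rightarrow> bool" where
  "valid_network N \<longleftrightarrow>
     requests N \<subseteq> {1..num_rx N} \<times> {1..num_files N} \<times> {1..num_subfiles N} \<and>
     (\<forall>m\<in>{1..num_bs N}. power_max N m \<ge> 0) \<and>
     noise N > 0 \<and> noise_eve N > 0 \<and>
     (\<forall>\<rho>\<in>requests N. rate_req N \<rho> > 0 \<and> rate_tol N \<rho> \<ge> 0 \<and>
        chan N \<rho> \<in> carrier_vec (tx_dim N)) \<and>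
     chan_eve N \<in> carrier_mat (tx_dim N) (num_eve_ant N)"

(* Stations are numbered from 1, matrix entries from 0: station m owns the
   entries (m - 1) * N_t, ..., m * N_t - 1. *)
definition bs_block :: "network \<Rightarrow> nat \<Rightarrow> complex mat" where
  "bs_block N m = mat (tx_dim N) (tx_dim N) (\<lambda>(i, j).
     if i = j \<and> (m - 1) * num_tx_ant N \<le> i \<and> i < m * num_tx_ant N then 1 else 0)"

definition sinr :: "network \<Rightarrow> (request \<Rightarrow> complex vec) \<Rightarrow> request \<Rightarrow> real" where
  "sinr N w \<rho> =
     (1 / noise N * (cmod (w \<rho> \<bullet>c chan N \<rho>))\<^sup>2) /
     (1 + 1 / noise N * (\<Sum>\<rho>'\<in>requests N - {\<rho>}. (cmod (w \<rho>' \<bullet>c chan N \<rho>))\<^sup>2))"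

definition rate :: "network \<Rightarrow> (request \<Rightarrow> complex vec) \<Rightarrow> request \<Rightarrow> real" where
  "rate N w \<rho> = log 2 (1 + sinr N w \<rho>)"

(* The determinant is real, being that of a Hermitian matrix. *)
definition rate_eve :: "network \<Rightarrow> (request \<Rightarrow> complex vec) \<Rightarrow> request \<Rightarrow> real" where
  "rate_eve N w \<rho> = log 2 (Re (det (1\<^sub>m (num_eve_ant N) +
     complex_of_real (1 / noise_eve N) \<cdot>\<^sub>m
       (mat_adjoint (chan_eve N) * outer (w \<rho>) * chan_eve N))))"

definition chan_mat :: "network \<Rightarrow> request \<Rightarrow> complex mat" where
  "chan_mat N \<rho> = outer (chan N \<rho>)"

definition kappa_req :: "network \<Rightarrow> request \<Rightarrow> real" where
  "kappa_req N \<rho> = 2 powr rate_req N \<rho> - 1"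

definition kappa_tol :: "network \<Rightarrow> request \<Rightarrow> real" where
  "kappa_tol N \<rho> = 2 powr rate_tol N \<rho> - 1"

definition R0_feasible ::
  "network \<Rightarrow> (nat \<Rightarrow> nat \<Rightarrow> nat \<Rightarrow> nat) \<Rightarrow> (request \<Rightarrow> complex vec) \<Rightarrow> bool" where
  "R0_feasible N q w \<longleftrightarrow>
     (\<forall>\<rho>\<in>requests N. w \<rho> \<in> carrier_vec (tx_dim N)) \<and>
     (\<forall>m\<in>{1..num_bs N}. \<forall>(k, f, l)\<in>requests N.
        Re (tr (bs_block N m * outer (w (k, f, l)))) \<le> real (q f l m) * power_max N m) \<and>
     (\<forall>m\<in>{1..num_bs N}.
        Re (tr (mat_sum (tx_dim N) (\<lambda>\<rho>. bs_block N m * outer (w \<rho>)) (requests N)))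
          \<le> power_max N m) \<and>
     (\<forall>\<rho>\<in>requests N. rate N w \<rho> \<ge> rate_req N \<rho>) \<and>
     (\<forall>\<rho>\<in>requests N. rate_eve N w \<rho> \<le> rate_tol N \<rho>)"

definition R0_objective :: "network \<Rightarrow> (request \<Rightarrow> complex vec) \<Rightarrow> real" where
  "R0_objective N w = (\<Sum>\<rho>\<in>requests N. Re (tr (outer (w \<rho>))))"

definition R1_feasible ::
  "network \<Rightarrow> (nat \<Rightarrow> nat \<Rightarrow> nat \<Rightarrow> nat) \<Rightarrow> (request \<Rightarrow> complex mat) \<Rightarrow> bool" where
  "R1_feasible N q W \<longleftrightarrow>
     (\<forall>\<rho>\<in>requests N. hermitian (tx_dim N) (W \<rho>)) \<and>
     (\<forall>m\<in>{1..num_bs N}. \<forall>(k, f, l)\<in>requests N.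
        Re (tr (bs_block N m * W (k, f, l))) \<le> real (q f l m) * power_max N m) \<and>
     (\<forall>m\<in>{1..num_bs N}.
        Re (tr (mat_sum (tx_dim N) (\<lambda>\<rho>. bs_block N m * W \<rho>) (requests N)))
          \<le> power_max N m) \<and>
     (\<forall>\<rho>\<in>requests N.
        1 / kappa_req N \<rho> * Re (tr (W \<rho> * chan_mat N \<rho>)) \<ge>
          noise N + (\<Sum>\<rho>'\<in>requests N - {\<rho>}. Re (tr (W \<rho>' * chan_mat N \<rho>)))) \<and>
     (\<forall>\<rho>\<in>requests N.
        loewner_le (num_eve_ant N)
          (mat_adjoint (chan_eve N) * W \<rho> * chan_eve N)
          (complex_of_real (noise_eve N * kappa_tol N \<rho>) \<cdot>\<^sub>m 1\<^sub>m (num_eve_ant N))) \<and>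
     (\<forall>\<rho>\<in>requests N. psd (tx_dim N) (W \<rho>))"

definition R1_objective :: "network \<Rightarrow> (request \<Rightarrow> complex mat) \<Rightarrow> real" where
  "R1_objective N W = Re (tr (mat_sum (tx_dim N) W (requests N)))"

end

(* Given an R1-feasible W, replace each W_rho by w w^H with
   w = W_rho h_rho / sqrt (h_rho^H W_rho h_rho). By Cauchy-Schwarz for the form of W_rho,
   w w^H \<preceq> W_rho, so transmit powers, interference and leakage do not grow, while the useful
   signal h_rho^H W_rho h_rho, which (C6) forces to be positive, is unchanged. The objective drops
   by the trace of the positive semidefinite differences W_rho - w w^H; at an optimum these traces
   vanish, hence so do the differences. For rank-one matrices the rate constraints (C6), (C7) are
   equivalent to their R1 counterparts, (C7) via det (I + c u u^H) = 1 + c |u|^2. *)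
theory Submission
  imports Defs
begin

section \<open>Adjoints and the standard Hermitian inner product\<close>

lemma mat_adjoint_carrier [simp]:
  "A \<in> carrier_mat n m \<Longrightarrow> mat_adjoint A \<in> carrier_mat m n"
  unfolding mat_adjoint_def by auto

lemma mat_adjoint_index:
  fixes A :: "complex mat"
  assumes "A \<in> carrier_mat n m" "i < m" "j < n"
  shows "mat_adjoint A $$ (i, j) = cnj (A $$ (j, i))"
  using assms unfolding mat_adjoint_def by (auto simp: mat_of_rows_def)

lemma mat_adjoint_dims [simp]:
  "dim_row (mat_adjoint A) = dim_col A" "dim_col (mat_adjoint A) = dim_row A"
  unfolding mat_adjoint_def by auto

lemma cscalar_swap:
  fixes x y :: "complex vec"
  assumes "x \<in> carrier_vec n" "y \<in> carrier_vec n"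
  shows "cnj (x \<bullet>c y) = y \<bullet>c x"
  using assms unfolding scalar_prod_def by (auto simp: mult.commute)

lemma cscalar_self:
  fixes x :: "complex vec"
  assumes "x \<in> carrier_vec n"
  shows "x \<bullet>c x = complex_of_real (\<Sum>i<n. (cmod (x $ i))\<^sup>2)"
  using assms unfolding scalar_prod_def
  by (auto simp: lessThan_atLeast0 simp flip: complex_norm_square intro!: sum.cong)

lemma cscalar_self_nonneg: "0 \<le> Re (x \<bullet>c (x :: complex vec))"
  by (subst cscalar_self[of _ "dim_vec x"]) (auto intro: sum_nonneg)

lemma mat_vec_index_sum:
  assumes "A \<in> carrier_mat n m" "x \<in> carrier_vec m" "i < n"
  shows "(A *\<^sub>v x) $ i = (\<Sum>j<m. A $$ (i, j) * x $ j)"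
  using assms by (auto simp: scalar_prod_def lessThan_atLeast0 intro!: sum.cong)

lemma cscalar_sum:
  fixes x y :: "complex vec"
  assumes "y \<in> carrier_vec n"
  shows "x \<bullet>c y = (\<Sum>i<n. x $ i * cnj (y $ i))"
  using assms by (auto simp: scalar_prod_def lessThan_atLeast0 intro!: sum.cong)

lemma form_sum:
  fixes A :: "complex mat"
  assumes "A \<in> carrier_mat n m" "x \<in> carrier_vec m" "y \<in> carrier_vec n"
  shows "(A *\<^sub>v x) \<bullet>c y = (\<Sum>i<n. \<Sum>j<m. A $$ (i, j) * x $ j * cnj (y $ i))"
  using assms by (simp add: cscalar_sum mat_vec_index_sum sum_distrib_right del: index_mult_mat_vec)

text \<open>Both sides expand to the same double sum once the order of summation is exchanged. This
  is how matrices move from one argument of the inner product to the other below.\<close>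

lemma mat_adjoint_form:
  fixes A :: "complex mat"
  assumes A: "A \<in> carrier_mat n m" and x: "x \<in> carrier_vec m" and y: "y \<in> carrier_vec n"
  shows "x \<bullet>c (mat_adjoint A *\<^sub>v y) = (A *\<^sub>v x) \<bullet>c y"
proof -
  have "(mat_adjoint A *\<^sub>v y) \<bullet>c x = (\<Sum>i<m. \<Sum>j<n. cnj (A $$ (j, i)) * y $ j * cnj (x $ i))"
    by (subst form_sum[OF mat_adjoint_carrier[OF A] y x])
      (auto simp: mat_adjoint_index[OF A])
  also have "\<dots> = cnj ((A *\<^sub>v x) \<bullet>c y)"
    by (subst form_sum[OF A x y], subst sum.swap) (auto simp: mult.commute mult.left_commute intro!: sum.cong)
  finally show ?thesis
    using cscalar_swap[of x m "mat_adjoint A *\<^sub>v y"] A x y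
    by (metis cscalar_swap complex_cnj_cnj mat_adjoint_carrier mult_mat_vec_carrier)
qed

lemma mat_minus_form:
  fixes A B :: "complex mat"
  assumes "A \<in> carrier_mat n n" "B \<in> carrier_mat n n" "x \<in> carrier_vec n" "y \<in> carrier_vec n"
  shows "((A - B) *\<^sub>v x) \<bullet>c y = (A *\<^sub>v x) \<bullet>c y - (B *\<^sub>v x) \<bullet>c y"
  using assms by (simp add: minus_mult_distrib_mat_vec minus_scalar_prod_distrib[where n = n])

section \<open>Hermitian and positive semidefinite matrices, and Cauchy-Schwarz for their
  forms\<close>

lemma hermitianD:
  assumes "hermitian n A"
  shows "A \<in> carrier_mat n n" "mat_adjoint A = A"
  using assms unfolding hermitian_def by auto

text \<open>Entrywise symmetry is easier to verify than an equation between adjoints: closure under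
  differences and congruences becomes a computation with single entries.\<close>

lemma hermitian_iff:
  "hermitian n A \<longleftrightarrow> A \<in> carrier_mat n n \<and> (\<forall>i<n. \<forall>j<n. cnj (A $$ (j, i)) = A $$ (i, j))"
proof (cases "A \<in> carrier_mat n n")
  case True
  show ?thesis
  proof
    assume "hermitian n A"
    then show "A \<in> carrier_mat n n \<and> (\<forall>i<n. \<forall>j<n. cnj (A $$ (j, i)) = A $$ (i, j))"
      using mat_adjoint_index[OF True] unfolding hermitian_def by metis
  next
    assume "A \<in> carrier_mat n n \<and> (\<forall>i<n. \<forall>j<n. cnj (A $$ (j, i)) = A $$ (i, j))"
    then have sym: "cnj (A $$ (j, i)) = A $$ (i, j)" if "i < n" "j < n" for i j
      using that by blast
    have "mat_adjoint A = A"
      using True by (intro eq_matI) (simp_all add: mat_adjoint_index[OF True] sym)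
    then show "hermitian n A" using True by (simp add: hermitian_def)
  qed
qed (simp add: hermitian_def)

lemma hermitian_minus:
  assumes "hermitian n A" "hermitian n B"
  shows "hermitian n (A - B)"
  using assms unfolding hermitian_iff by auto

lemma hermitian_congruence:
  assumes A: "hermitian n A" and G: "G \<in> carrier_mat n k"
  shows "hermitian k (mat_adjoint G * A * G)"
proof -
  let ?B = "mat_adjoint G * A * G"
  have AC: "A \<in> carrier_mat n n" and Asym: "\<And>i j. i < n \<Longrightarrow> j < n \<Longrightarrow> cnj (A $$ (j, i)) = A $$ (i, j)"
    using A by (auto simp: hermitian_iff)
  have ent: "?B $$ (i, j) = (\<Sum>q<n. \<Sum>p<n. cnj (G $$ (p, i)) * A $$ (p, q) * G $$ (q, j))"
    if "i < k" "j < k" for i j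
    using that G AC
    by (simp add: scalar_prod_def mat_adjoint_index[OF G] sum_distrib_right lessThan_atLeast0)
  \<comment> \<open>Conjugation exchanges the roles of the two summation indices; swapping the sums
    and using the symmetry of \<open>A\<close> restores them.\<close>
  have "cnj (?B $$ (j, i)) = ?B $$ (i, j)" if "i < k" "j < k" for i j
    unfolding ent[OF that] ent[OF that(2,1)]
    by (subst (2) sum.swap) (auto simp: Asym mult_ac intro!: sum.cong)
  then show ?thesis using G AC unfolding hermitian_iff by auto
qed

lemma psdD:
  assumes "psd n A"
  shows "A \<in> carrier_mat n n" "hermitian n A" "v \<in> carrier_vec n \<Longrightarrow> 0 \<le> Re ((A *\<^sub>v v) \<bullet>c v)"
  using assms unfolding psd_def hermitian_def by auto

text \<open>The form is nonnegative at \<open>x - t b y\<close> with \<open>b = y^H A x\<close> for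
  every real \<open>t\<close>, and a suitable \<open>t\<close> gives the bound. \<open>A\<close> may
  be singular, so \<open>Y = 0\<close> is a case of its own.\<close>

lemma psd_Cauchy_Schwarz:
  assumes A: "psd n A" and x: "x \<in> carrier_vec n" and y: "y \<in> carrier_vec n"
  shows "(cmod ((A *\<^sub>v x) \<bullet>c y))\<^sup>2 \<le> Re ((A *\<^sub>v x) \<bullet>c x) * Re ((A *\<^sub>v y) \<bullet>c y)"
proof -
  note C = psdD(1)[OF A]
  define b where "b = (A *\<^sub>v x) \<bullet>c y"
  define X where "X = Re ((A *\<^sub>v x) \<bullet>c x)"
  define Y where "Y = Re ((A *\<^sub>v y) \<bullet>c y)"
  have cb: "(A *\<^sub>v y) \<bullet>c x = cnj b"
    unfolding b_def cscalar_swap[OF mult_mat_vec_carrier[OF C x] y]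
    using mat_adjoint_form[OF C y x] unfolding hermitianD(2)[OF psdD(2)[OF A]] by (rule sym)
  have main: "0 \<le> X - 2 * t * (cmod b)\<^sup>2 + t\<^sup>2 * (cmod b)\<^sup>2 * Y" for t :: real
  proof -
    \<comment> \<open>The factor \<open>b\<close> aligns the phases: both cross terms equal
      \<open>- t |b|^2\<close>, so a real parameter suffices.\<close>
    define s where "s = - complex_of_real t * b"
    let ?z = "x + s \<cdot>\<^sub>v y"
    have "(A *\<^sub>v ?z) \<bullet>c ?z = (A *\<^sub>v x) \<bullet>c x + cnj s * b + s * cnj b + s * cnj s * ((A *\<^sub>v y) \<bullet>c y)"
      using C x y
      by (simp add: mult_add_distrib_mat_vec[where nr = n and nc = n] mult_mat_vec[where nr = n and nc = n]
          add_scalar_prod_distrib[where n = n] scalar_prod_add_distrib[where n = n]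
          conjugate_add_vec[where n = n] conjugate_smult_vec cb b_def[symmetric] algebra_simps)
    also have "\<dots> = (A *\<^sub>v x) \<bullet>c x - of_real (2 * t * (cmod b)\<^sup>2) + of_real (t\<^sup>2 * (cmod b)\<^sup>2) * ((A *\<^sub>v y) \<bullet>c y)"
      unfolding s_def of_real_mult complex_norm_square by (simp add: algebra_simps power2_eq_square)
    finally have "Re ((A *\<^sub>v ?z) \<bullet>c ?z) = X - 2 * t * (cmod b)\<^sup>2 + t\<^sup>2 * (cmod b)\<^sup>2 * Y"
      by (simp add: X_def Y_def)
    then show ?thesis using psdD(3)[OF A, of ?z] x y by simp
  qed
  have Y0: "0 \<le> Y" unfolding Y_def by (rule psdD(3)[OF A y])
  have "(cmod b)\<^sup>2 \<le> X * Y"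
  proof (cases "Y = 0")
    case True
    have "b = 0"
    proof (rule ccontr)
      assume "b \<noteq> 0"
      \<comment> \<open>For \<open>Y = 0\<close> the lower bound is linear in \<open>t\<close>; at
        this \<open>t\<close> it equals -1.\<close>
      then show False using main[of "(X + 1) / (2 * (cmod b)\<^sup>2)"] True
        by (simp add: field_simps)
    qed
    then show ?thesis using True by simp
  next
    case False
    \<comment> \<open>The quadratic in \<open>t\<close> is minimal at \<open>1 / Y\<close>, with
      value \<open>X - |b|^2 / Y\<close>.\<close>
    then show ?thesis using main[of "1 / Y"] Y0
      by (simp add: field_simps power2_eq_square)
  qed
  then show ?thesis unfolding b_def X_def Y_def .
qed

text \<open>Through unit vectors, inequalities for forms turn into inequalities for entries.\<close>

lemma form_unit_vec:
  fixes A :: "complex mat"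
  assumes A: "A \<in> carrier_mat n n" and i: "i < n" and j: "j < n"
  shows "(A *\<^sub>v unit_vec n j) \<bullet>c unit_vec n i = A $$ (i, j)"
proof -
  have "(A *\<^sub>v unit_vec n j) \<bullet>c unit_vec n i = (\<Sum>k<n. if k = i then (A *\<^sub>v unit_vec n j) $ k else 0)"
  proof (subst cscalar_sum[of _ n], simp, rule sum.cong[OF refl])
    fix k assume "k \<in> {..<n}"
    then show "(A *\<^sub>v unit_vec n j) $ k * cnj (unit_vec n i $ k) = (if k = i then (A *\<^sub>v unit_vec n j) $ k else 0)"
      using i by simp
  qed
  also have "\<dots> = row A i \<bullet> unit_vec n j" using i A by simp
  also have "\<dots> = A $$ (i, j)"
    using i j A by (subst scalar_prod_right_unit) auto
  finally show ?thesis .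
qed

lemma psd_diag_nonneg:
  assumes A: "psd n A" and i: "i < n"
  shows "0 \<le> Re (A $$ (i, i))"
  using psdD(3)[OF A, of "unit_vec n i"] form_unit_vec[OF psdD(1)[OF A] i i] by simp

text \<open>Cauchy-Schwarz at two unit vectors, that is, nonnegativity of the 2 by 2 principal
  minors. A zero on the diagonal thus annihilates its row and column.\<close>

lemma psd_offdiag:
  assumes A: "psd n A" and i: "i < n" and j: "j < n"
  shows "(cmod (A $$ (i, j)))\<^sup>2 \<le> Re (A $$ (j, j)) * Re (A $$ (i, i))"
  using psd_Cauchy_Schwarz[OF A, of "unit_vec n j" "unit_vec n i"]
    form_unit_vec[OF psdD(1)[OF A]] i j by simp

text \<open>The form of \<open>G^H A G\<close> at \<open>v\<close> is the form of \<open>A\<close>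
  at \<open>G v\<close>. With \<open>G\<close> the eavesdropper channel, this carries Loewner
  inequalities over to leakage matrices.\<close>

lemma psd_congruence:
  assumes A: "psd n A" and G: "G \<in> carrier_mat n k"
  shows "psd k (mat_adjoint G * A * G)"
proof -
  note C = psdD(1)[OF A]
  have "0 \<le> Re (((mat_adjoint G * A * G) *\<^sub>v v) \<bullet>c v)" if v: "v \<in> carrier_vec k" for v
  proof -
    have Gv: "G *\<^sub>v v \<in> carrier_vec n" using G v by simp
    then have AGv: "A *\<^sub>v (G *\<^sub>v v) \<in> carrier_vec n" using C by simp
    have "((mat_adjoint G * A * G) *\<^sub>v v) \<bullet>c v = (mat_adjoint G *\<^sub>v (A *\<^sub>v (G *\<^sub>v v))) \<bullet>c v"
      using assoc_mult_mat_vec[OF mult_carrier_mat[OF mat_adjoint_carrier[OF G] C] G v]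
        assoc_mult_mat_vec[OF mat_adjoint_carrier[OF G] C Gv] by simp
    also have "\<dots> = cnj (v \<bullet>c (mat_adjoint G *\<^sub>v (A *\<^sub>v (G *\<^sub>v v))))"
      by (rule cscalar_swap[symmetric, OF v]) (rule mult_mat_vec_carrier[OF mat_adjoint_carrier[OF G] AGv])
    also have "\<dots> = cnj ((G *\<^sub>v v) \<bullet>c (A *\<^sub>v (G *\<^sub>v v)))"
      by (simp only: mat_adjoint_form[OF G v AGv])
    also have "\<dots> = (A *\<^sub>v (G *\<^sub>v v)) \<bullet>c (G *\<^sub>v v)"
      by (rule cscalar_swap[OF Gv AGv])
    finally show ?thesis using psdD(3)[OF A Gv] by simp
  qed
  then show ?thesis unfolding psd_def using hermitian_congruence[OF psdD(2)[OF A] G] by blast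
qed

section \<open>Rank-one matrices \<open>w w^H\<close>\<close>

lemma outer_carrier [simp]: "w \<in> carrier_vec n \<Longrightarrow> outer w \<in> carrier_mat n n"
  unfolding outer_def by auto

lemma outer_dims [simp]: "dim_row (outer w) = dim_vec w" "dim_col (outer w) = dim_vec w"
  unfolding outer_def by auto

lemma outer_index: "i < dim_vec w \<Longrightarrow> j < dim_vec w \<Longrightarrow> outer w $$ (i, j) = w $ i * cnj (w $ j)"
  unfolding outer_def by auto

lemma outer_mult_vec:
  assumes "w \<in> carrier_vec n" "x \<in> carrier_vec n"
  shows "outer w *\<^sub>v x = (x \<bullet>c w) \<cdot>\<^sub>v w"
  using assms
  by (intro eq_vecI)
    (auto simp: mat_vec_index_sum[where n = n and m = n] outer_index cscalar_sum sum_distrib_right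
        sum_distrib_left mult_ac simp del: index_mult_mat_vec intro!: sum.cong)

lemma outer_form:
  assumes "w \<in> carrier_vec n" "x \<in> carrier_vec n"
  shows "(outer w *\<^sub>v x) \<bullet>c x = complex_of_real ((cmod (w \<bullet>c x))\<^sup>2)"
  unfolding complex_norm_square cscalar_swap[OF assms]
  using assms by (simp add: outer_mult_vec[where n = n] mult.commute)

lemma psd_outer:
  assumes "w \<in> carrier_vec n"
  shows "psd n (outer w)"
  using assms outer_form[OF assms]
  by (auto simp: psd_def hermitian_iff outer_index)

text \<open>Cyclicity of the trace in the rank-one case. The trace constraints with
  \<open>chan_mat\<close> thereby become values of quadratic forms at the channel vectors.\<close>

lemma tr_mult_outer:
  assumes "A \<in> carrier_mat n n" "h \<in> carrier_vec n"
  shows "tr (A * outer h) = (A *\<^sub>v h) \<bullet>c h"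
  using assms
  by (simp add: tr_def form_sum[where n = n and m = n] scalar_prod_def outer_index lessThan_atLeast0 mult_ac
      sum_distrib_left)

text \<open>Since \<open>(G^H w)^H = w^H G\<close>, the leakage matrix of a beamformer is again an
  outer product, with the received vector \<open>G^H w\<close> as its factor.\<close>

lemma adjoint_outer_congruence:
  assumes G: "G \<in> carrier_mat n k" and w: "w \<in> carrier_vec n"
  shows "mat_adjoint G * outer w * G = outer (mat_adjoint G *\<^sub>v w)"
proof (rule eq_matI)
  fix i j
  assume "i < dim_row (outer (mat_adjoint G *\<^sub>v w))" "j < dim_col (outer (mat_adjoint G *\<^sub>v w))"
  then have ij: "i < k" "j < k" using G by auto
  show "(mat_adjoint G * outer w * G) $$ (i, j) = outer (mat_adjoint G *\<^sub>v w) $$ (i, j)"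
    using ij G w
    by (simp add: outer_index scalar_prod_def mat_adjoint_index[OF G] sum_distrib_right
        sum_distrib_left lessThan_atLeast0 mult_ac)
qed (use G w in auto)

lemma det_one_plus_outer:
  fixes u :: "complex vec"
  assumes u: "u \<in> carrier_vec n"
  shows "det (1\<^sub>m n + c \<cdot>\<^sub>m outer u) = 1 + c * (u \<bullet>c u)"
proof -
  (* Factor the block matrix [[1, -V], [U, I]] once as lower times upper and once as upper times lower. *)
  define U where "U = mat n 1 (\<lambda>(i, j). u $ i)"
  define V where "V = mat 1 n (\<lambda>(i, j). c * cnj (u $ j))"
  have U: "U \<in> carrier_mat n 1" and V: "V \<in> carrier_mat 1 n" by (auto simp: U_def V_def)
  have UV: "U * V = c \<cdot>\<^sub>m outer u"
    using u by (intro eq_matI) (auto simp: U_def V_def scalar_prod_def outer_index)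
  have VU: "V * U = mat 1 1 (\<lambda>_. c * (u \<bullet>c u))"
    using u by (intro eq_matI)
      (auto simp: U_def V_def scalar_prod_def sum_distrib_left mult_ac intro!: sum.cong)
  let ?I = "1\<^sub>m n :: complex mat" and ?i = "1\<^sub>m 1 :: complex mat"
  let ?Z = "0\<^sub>m 1 n :: complex mat" and ?z = "0\<^sub>m n 1 :: complex mat"
  have I: "?I \<in> carrier_mat n n" and i: "?i \<in> carrier_mat 1 1" and Z: "?Z \<in> carrier_mat 1 n"
    and z: "?z \<in> carrier_mat n 1" and V': "- V \<in> carrier_mat 1 n"
    and P: "?I + U * V \<in> carrier_mat n n" and p: "?i + V * U \<in> carrier_mat 1 1"
    using U V by auto
  have "det (four_block_mat ?i (- V) U ?I) = det (?I + U * V)"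
  proof -
    have "four_block_mat ?i (- V) U ?I = four_block_mat ?i ?Z U ?I * four_block_mat ?i (- V) ?z (?I + U * V)"
    proof -
      have "U * - V + (?I + U * V) = ?I"
        using U V by (intro eq_matI) (auto simp: scalar_prod_def)
      then show ?thesis
        unfolding mult_four_block_mat[OF i Z U I i V' z P] using U V by simp
    qed
    also have "det \<dots> = det (four_block_mat ?i ?Z U ?I) * det (four_block_mat ?i (- V) ?z (?I + U * V))"
      by (rule det_mult[where n = "1 + n"]) (use U V in auto)
    also have "\<dots> = det (?I + U * V)"
      by (simp only: det_four_block_mat_upper_right_zero[OF i refl U I]
          det_four_block_mat_lower_left_zero[OF i V' refl P] det_one mult_1)
    finally show ?thesis .
  qed
  moreover have "det (four_block_mat ?i (- V) U ?I) = det (?i + V * U)"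
  proof -
    have "four_block_mat ?i (- V) U ?I = four_block_mat (?i + V * U) (- V) ?z ?I * four_block_mat ?i ?Z U ?I"
    proof -
      have "?i + V * U + - V * U = ?i"
        using U V by (intro eq_matI) (auto simp: scalar_prod_def)
      then show ?thesis
        unfolding mult_four_block_mat[OF p V' z I i Z U I] using U V by simp
    qed
    also have "det \<dots> = det (four_block_mat (?i + V * U) (- V) ?z ?I) * det (four_block_mat ?i ?Z U ?I)"
      by (rule det_mult[where n = "1 + n"]) (use U V in auto)
    also have "\<dots> = det (?i + V * U)"
      by (simp only: det_four_block_mat_upper_right_zero[OF i refl U I]
          det_four_block_mat_lower_left_zero[OF p V' refl I] det_one mult_1_right)
    finally show ?thesis .
  qed
  moreover have "det (?i + V * U) = 1 + c * (u \<bullet>c u)"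
    using det_single[OF p] by (simp add: VU)
  ultimately show ?thesis unfolding UV by simp
qed

section \<open>Vanishing traces and the Loewner order\<close>

lemma psd_trace_zero:
  assumes A: "psd n A" and tr0: "Re (tr A) \<le> 0"
  shows "A = 0\<^sub>m n n"
proof -
  note C = psdD(1)[OF A]
  have "(\<Sum>i<n. Re (A $$ (i, i))) = 0"
    using C tr0 psd_diag_nonneg[OF A] sum_nonneg[of "{..<n}" "\<lambda>i. Re (A $$ (i, i))"]
    by (auto simp: tr_def)
  then have diag: "Re (A $$ (i, i)) = 0" if "i < n" for i
    using that psd_diag_nonneg[OF A] by (subst (asm) sum_nonneg_eq_0_iff) auto
  \<comment> \<open>Each entry is bounded by a product of two diagonal entries, all of which are
    zero.\<close>
  have "A $$ (i, j) = 0" if "i < n" "j < n" for i j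
    using psd_offdiag[OF A that] diag that by simp
  then show ?thesis using C by (intro eq_matI) auto
qed

text \<open>Transitivity of the Loewner order: the form of \<open>A - C\<close> is the sum of the
  forms of \<open>A - B\<close> and \<open>B - C\<close>.\<close>

lemma psd_minus_trans:
  assumes A: "hermitian n A" and B: "B \<in> carrier_mat n n" and C: "hermitian n C"
    and AB: "psd n (A - B)" and BC: "psd n (B - C)"
  shows "psd n (A - C)"
proof -
  have "0 \<le> Re (((A - C) *\<^sub>v v) \<bullet>c v)" if v: "v \<in> carrier_vec n" for v
    using psdD(3)[OF AB v] psdD(3)[OF BC v] hermitianD(1)[OF A] hermitianD(1)[OF C] B v
    by (simp add: mat_minus_form[where n = n])
  then show ?thesis unfolding psd_def using hermitian_minus[OF A C] by blast
qed

lemma psd_minus_self: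
  assumes A: "psd n A"
  shows "psd n (A - A)"
proof -
  have "((A - A) *\<^sub>v v) \<bullet>c v = 0" if "v \<in> carrier_vec n" for v
    unfolding mat_minus_form[OF psdD(1)[OF A] psdD(1)[OF A] that that] by simp
  then show ?thesis
    unfolding psd_def using hermitian_minus[OF psdD(2)[OF A] psdD(2)[OF A]] by simp
qed

text \<open>A Hermitian form at a single vector equals its own conjugate, so passing to
  \<open>Re\<close> loses nothing.\<close>

lemma psd_form_real:
  assumes A: "psd n A" and v: "v \<in> carrier_vec n"
  shows "(A *\<^sub>v v) \<bullet>c v = complex_of_real (Re ((A *\<^sub>v v) \<bullet>c v))"
proof -
  note C = psdD(1)[OF A]
  have "v \<bullet>c (A *\<^sub>v v) = (A *\<^sub>v v) \<bullet>c v"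
    using mat_adjoint_form[OF C v v] hermitianD(2)[OF psdD(2)[OF A]] by simp
  moreover have "cnj ((A *\<^sub>v v) \<bullet>c v) = v \<bullet>c (A *\<^sub>v v)"
    by (rule cscalar_swap[OF _ v]) (use C v in auto)
  ultimately show ?thesis by (metis Reals_cnj_iff of_real_Re)
qed

lemma psd_minus_form_le:
  assumes "psd n (A - B)" "A \<in> carrier_mat n n" "B \<in> carrier_mat n n" "v \<in> carrier_vec n"
  shows "Re ((B *\<^sub>v v) \<bullet>c v) \<le> Re ((A *\<^sub>v v) \<bullet>c v)"
  using psdD(3)[OF assms(1,4)] assms(2-) by (simp add: mat_minus_form[where n = n])

lemma psd_minus_diag_le:
  assumes "psd n (A - B)" "A \<in> carrier_mat n n" "B \<in> carrier_mat n n" "i < n"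
  shows "Re (B $$ (i, i)) \<le> Re (A $$ (i, i))"
  using psd_diag_nonneg[OF assms(1,4)] assms(2-) by simp

lemma hermitian_scaled_one: "hermitian n (complex_of_real c \<cdot>\<^sub>m 1\<^sub>m n)"
  by (auto simp: hermitian_iff)

lemma scaled_one_form:
  assumes "v \<in> carrier_vec n"
  shows "((complex_of_real c \<cdot>\<^sub>m 1\<^sub>m n) *\<^sub>v v) \<bullet>c v = complex_of_real c * (v \<bullet>c v)"
proof -
  have "(complex_of_real c \<cdot>\<^sub>m 1\<^sub>m n) *\<^sub>v v = complex_of_real c \<cdot>\<^sub>v v"
    using assms by (intro eq_vecI) (auto simp: smult_scalar_prod_distrib)
  then show ?thesis using assms by simp
qed

lemma psd_one: "psd n (1\<^sub>m n)"
  using hermitian_scaled_one[of n 1] cscalar_self_nonneg unfolding psd_def by (auto simp: hermitian_iff)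

text \<open>This expresses that the largest eigenvalue of \<open>u u^H\<close> is
  \<open>|u|^2\<close>, without recourse to the spectrum: the vector \<open>u\<close> itself tests
  necessity, and Cauchy-Schwarz for the identity matrix gives sufficiency.\<close>

lemma psd_scaled_one_minus_outer:
  assumes u: "u \<in> carrier_vec n" and c: "0 \<le> c"
  shows "psd n (complex_of_real c \<cdot>\<^sub>m 1\<^sub>m n - outer u) \<longleftrightarrow> Re (u \<bullet>c u) \<le> c"
proof -
  have form: "Re (((complex_of_real c \<cdot>\<^sub>m 1\<^sub>m n - outer u) *\<^sub>v v) \<bullet>c v) = c * Re (v \<bullet>c v) - (cmod (u \<bullet>c v))\<^sup>2"
    if "v \<in> carrier_vec n" for v
    using u that by (simp add: mat_minus_form[where n = n] scaled_one_form outer_form[where n = n])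
  show ?thesis
  proof
    assume P: "psd n (complex_of_real c \<cdot>\<^sub>m 1\<^sub>m n - outer u)"
    define r where "r = Re (u \<bullet>c u)"
    have r: "u \<bullet>c u = complex_of_real r" "0 \<le> r"
      using cscalar_self[OF u] cscalar_self_nonneg[of u] by (auto simp: r_def)
    \<comment> \<open>This is the form at \<open>v = u\<close>. A positive \<open>r\<close> cancels,
      and \<open>r = 0\<close> is covered by \<open>0 <= c\<close>.\<close>
    have "0 \<le> c * r - r\<^sup>2" using psdD(3)[OF P u] form[OF u] r by simp
    then show "Re (u \<bullet>c u) \<le> c"
      using r c by (cases "r = 0") (auto simp: power2_eq_square mult_le_cancel_right)
  next
    assume uc: "Re (u \<bullet>c u) \<le> c"
    have "(cmod (u \<bullet>c v))\<^sup>2 \<le> c * Re (v \<bullet>c v)" if v: "v \<in> carrier_vec n" for v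
    proof -
      have "(cmod (u \<bullet>c v))\<^sup>2 \<le> Re (u \<bullet>c u) * Re (v \<bullet>c v)"
        using psd_Cauchy_Schwarz[OF psd_one u v] u v by simp
      also have "\<dots> \<le> c * Re (v \<bullet>c v)"
        by (rule mult_right_mono[OF uc cscalar_self_nonneg])
      finally show ?thesis .
    qed
    then show "psd n (complex_of_real c \<cdot>\<^sub>m 1\<^sub>m n - outer u)"
      using form hermitian_minus[OF hermitian_scaled_one psdD(2)[OF psd_outer[OF u]]]
      by (simp add: psd_def)
  qed
qed

section \<open>The rank-one part of a semidefinite matrix along a channel vector\<close>

definition rank_one_part :: "complex mat \<Rightarrow> complex vec \<Rightarrow> complex vec" where
  "rank_one_part A h = complex_of_real (1 / sqrt (Re ((A *\<^sub>v h) \<bullet>c h))) \<cdot>\<^sub>v (A *\<^sub>v h)"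

text \<open>The normalisation gives \<open>|w^H v|^2 = |v^H A h|^2 / (h^H A h)\<close> for all
  \<open>v\<close>. By Cauchy-Schwarz this is at most \<open>v^H A v\<close>, and equality at
  \<open>v = h\<close> preserves the signal.\<close>

lemma rank_one_part:
  assumes A: "psd n A" and h: "h \<in> carrier_vec n" and pos: "0 < Re ((A *\<^sub>v h) \<bullet>c h)"
  shows "rank_one_part A h \<in> carrier_vec n"
    and "psd n (A - outer (rank_one_part A h))"
    and "Re (tr (outer (rank_one_part A h) * outer h)) = Re (tr (A * outer h))"
proof -
  note C = psdD(1)[OF A]
  define w where "w = rank_one_part A h"
  define s where "s = Re ((A *\<^sub>v h) \<bullet>c h)"
  have w: "w \<in> carrier_vec n" unfolding w_def rank_one_part_def using C h by auto
  then show "rank_one_part A h \<in> carrier_vec n" by (simp add: w_def)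
  have ws: "(cmod (w \<bullet>c v))\<^sup>2 = (cmod ((A *\<^sub>v h) \<bullet>c v))\<^sup>2 / s" if v: "v \<in> carrier_vec n" for v
  proof -
    have "w \<bullet>c v = complex_of_real (1 / sqrt s) * ((A *\<^sub>v h) \<bullet>c v)"
      unfolding w_def rank_one_part_def s_def using C h v by (intro smult_scalar_prod_distrib[where n = n]) auto
    then show ?thesis using pos by (simp add: norm_mult norm_divide power_mult_distrib power_divide s_def)
  qed
  have "0 \<le> Re (((A - outer w) *\<^sub>v v) \<bullet>c v)" if v: "v \<in> carrier_vec n" for v
    using psd_Cauchy_Schwarz[OF A h v] pos C w v
    by (simp add: mat_minus_form[where n = n] outer_form[OF w] ws[OF v] field_simps flip: s_def)
  then show "psd n (A - outer (rank_one_part A h))"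
    unfolding psd_def w_def[symmetric]
    using hermitian_minus[OF psdD(2)[OF A] psdD(2)[OF psd_outer[OF w]]] by blast
  have "(cmod ((A *\<^sub>v h) \<bullet>c h))\<^sup>2 = s\<^sup>2"
    by (subst psd_form_real[OF A h]) (simp add: s_def)
  then have "(cmod (w \<bullet>c h))\<^sup>2 = s"
    using ws[OF h] pos by (simp add: power2_eq_square s_def)
  then show "Re (tr (outer (rank_one_part A h) * outer h)) = Re (tr (A * outer h))"
    unfolding w_def[symmetric] using w h C
    by (simp add: tr_mult_outer[where n = n] outer_form[OF w h] flip: s_def)
qed

section \<open>Eigenvectors and rank of \<open>w w^H\<close>\<close>

lemma outer_smult:
  "outer (c \<cdot>\<^sub>v v) = (c * cnj c) \<cdot>\<^sub>m outer v"
  by (intro eq_matI) (auto simp: outer_index)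

lemma cscalar_self_pos:
  assumes "w \<in> carrier_vec n" "w \<noteq> 0\<^sub>v n"
  shows "0 < Re (w \<bullet>c w)"
proof -
  have "\<exists>i<n. w $ i \<noteq> 0" using assms by (metis carrier_vecD eq_vecI index_zero_vec(1,2))
  then have "0 < (\<Sum>i<n. (cmod (w $ i))\<^sup>2)"
    by (auto intro!: sum_pos2)
  then show ?thesis using cscalar_self[OF assms(1)] by simp
qed

lemma eigenvector_outer_self:
  assumes "w \<in> carrier_vec n" "w \<noteq> 0\<^sub>v n"
  shows "eigenvector (outer w) w (w \<bullet>c w)"
  using assms by (simp add: eigenvector_def outer_mult_vec[where n = n] carrier_vecD)

text \<open>The eigenvector equation reads \<open>(w^H v) w = k v\<close>. With \<open>k\<close>
  nonzero, \<open>w^H v\<close> cannot vanish, so \<open>v\<close> and \<open>w\<close> are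
  parallel; pairing the equation with \<open>w\<close> identifies \<open>k\<close>.\<close>

lemma eigenvector_outer_cases:
  assumes w: "w \<in> carrier_vec n" and ev: "eigenvector (outer w) v k" and k: "k \<noteq> 0"
  shows "k = w \<bullet>c w" and "\<exists>d. d \<noteq> 0 \<and> w = d \<cdot>\<^sub>v v"
proof -
  have v: "v \<in> carrier_vec n" "v \<noteq> 0\<^sub>v n" and e: "(v \<bullet>c w) \<cdot>\<^sub>v w = k \<cdot>\<^sub>v v"
    using ev w by (auto simp: eigenvector_def outer_mult_vec[where n = n] carrier_vecD)
  have nz: "v \<bullet>c w \<noteq> 0"
  proof
    assume "v \<bullet>c w = 0"
    with e have e0: "0 \<cdot>\<^sub>v w = k \<cdot>\<^sub>v v" by simp
    have "v $ i = 0" if "i < n" for i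
      using arg_cong[OF e0, of "\<lambda>x. x $ i"] that v w k by simp
    then have "v = 0\<^sub>v n" using v by (intro eq_vecI) auto
    with v show False by simp
  qed
  have "(v \<bullet>c w) * (w \<bullet>c w) = k * (v \<bullet>c w)"
    using arg_cong[OF e, of "\<lambda>x. x \<bullet>c w"] v w by simp
  with nz show "k = w \<bullet>c w" by simp
  have "w = (k / (v \<bullet>c w)) \<cdot>\<^sub>v v"
  proof (rule eq_vecI)
    fix i assume "i < dim_vec ((k / (v \<bullet>c w)) \<cdot>\<^sub>v v)"
    then have i: "i < n" using v by simp
    have "(v \<bullet>c w) * w $ i = k * v $ i"
      using arg_cong[OF e, of "\<lambda>x. x $ i"] i v w by simp
    then show "w $ i = ((k / (v \<bullet>c w)) \<cdot>\<^sub>v v) $ i"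
      using nz i v by (simp add: field_simps)
  qed (use v w in simp)
  with nz k show "\<exists>d. d \<noteq> 0 \<and> w = d \<cdot>\<^sub>v v"
    by (intro exI[of _ "k / (v \<bullet>c w)"]) simp
qed

text \<open>Every nonzero eigenvalue equals \<open>|w|^2\<close>, which is nonnegative, so none
  exceeds the eigenvalue of \<open>w\<close>.\<close>

lemma principal_eigenvector_outer_self:
  assumes w: "w \<in> carrier_vec n" "w \<noteq> 0\<^sub>v n"
  shows "principal_eigenvector (outer w) w"
proof -
  have "Re \<mu> \<le> Re (w \<bullet>c w)" if "eigenvalue (outer w) \<mu>" for \<mu>
    using that eigenvector_outer_cases(1)[OF w(1)] cscalar_self_nonneg[of w]
    unfolding eigenvalue_def by (cases "\<mu> = 0") auto
  then show ?thesis unfolding principal_eigenvector_def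
    using eigenvector_outer_self[OF w] by blast
qed

text \<open>The eigenvalue of \<open>v\<close> is at least \<open>|w|^2 > 0\<close>, hence nonzero,
  which makes \<open>w\<close> a multiple \<open>d v\<close>.\<close>

lemma principal_eigenvector_outer_scaled:
  assumes w: "w \<in> carrier_vec n" "w \<noteq> 0\<^sub>v n" and pe: "principal_eigenvector (outer w) v"
  shows "\<exists>c>0. outer (complex_of_real c \<cdot>\<^sub>v v) = outer w"
proof -
  obtain k where ev: "eigenvector (outer w) v k"
    and le: "\<And>\<mu>. eigenvalue (outer w) \<mu> \<Longrightarrow> Re \<mu> \<le> Re k"
    using pe unfolding principal_eigenvector_def by blast
  have "Re (w \<bullet>c w) \<le> Re k"
    using le eigenvector_outer_self[OF w] unfolding eigenvalue_def by blast
  then have "k \<noteq> 0" using cscalar_self_pos[OF w] by auto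
  then obtain d where d: "d \<noteq> 0" "w = d \<cdot>\<^sub>v v"
    using eigenvector_outer_cases(2)[OF w(1) ev] by blast
  \<comment> \<open>The phase of \<open>d\<close> cancels in \<open>(d v) (d v)^H\<close>, so the
    real positive factor \<open>|d|\<close> does the same.\<close>
  have "outer (complex_of_real (cmod d) \<cdot>\<^sub>v v) = outer w"
    unfolding d(2) outer_smult by (simp add: complex_norm_square[symmetric] power2_eq_square)
  then show ?thesis using d(1) by (intro exI[of _ "cmod d"]) simp
qed

lemma rank_outer_le_1:
  assumes "w \<in> carrier_vec n"
  shows "vec_space.rank n (outer w) \<le> 1"
  by (rule vec_space.rank_le_1_product_entries[where f = "\<lambda>i. w $ i" and g = "\<lambda>j. cnj (w $ j)" and nc = n])
    (use assms in \<open>auto simp: outer_index\<close>)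

section \<open>Traces, and the power drawn by one base station\<close>

lemma tr_mat_sum:
  assumes "\<And>x. x \<in> I \<Longrightarrow> A x \<in> carrier_mat n n"
  shows "tr (mat_sum n A I) = (\<Sum>x\<in>I. tr (A x))"
proof -
  have "tr (mat_sum n A I) = (\<Sum>x\<in>I. \<Sum>i<n. A x $$ (i, i))"
    unfolding tr_def mat_sum_def by (subst sum.swap) simp
  also have "\<dots> = (\<Sum>x\<in>I. tr (A x))"
    using assms by (intro sum.cong) (auto simp: tr_def)
  finally show ?thesis .
qed

lemma bs_block_carrier [simp]: "bs_block N m \<in> carrier_mat (tx_dim N) (tx_dim N)"
  unfolding bs_block_def by simp

lemma bs_block_dims [simp]: "dim_row (bs_block N m) = tx_dim N" "dim_col (bs_block N m) = tx_dim N"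
  unfolding bs_block_def by simp_all

text \<open>Left multiplication by the 0-1 diagonal matrix keeps the rows of one block and erases
  the others, so only diagonal entries of \<open>A\<close> enter. Hence transmit power is monotone
  in the Loewner order.\<close>

lemma tr_bs_block:
  assumes A: "A \<in> carrier_mat (tx_dim N) (tx_dim N)"
  shows "tr (bs_block N m * A) =
    (\<Sum>i<tx_dim N. if (m - 1) * num_tx_ant N \<le> i \<and> i < m * num_tx_ant N then A $$ (i, i) else 0)"
proof -
  have "(bs_block N m * A) $$ (i, i) =
      (if (m - 1) * num_tx_ant N \<le> i \<and> i < m * num_tx_ant N then A $$ (i, i) else 0)"
    if i: "i < tx_dim N" for i
  proof -
    have "(bs_block N m * A) $$ (i, i) = (\<Sum>j = 0..<tx_dim N. bs_block N m $$ (i, j) * A $$ (j, i))"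
      using A i bs_block_carrier[of N m] by (simp add: scalar_prod_def)
    also have "\<dots> = (\<Sum>j = 0..<tx_dim N. if j = i then
        (if (m - 1) * num_tx_ant N \<le> i \<and> i < m * num_tx_ant N then A $$ (i, i) else 0) else 0)"
      using i by (intro sum.cong) (auto simp: bs_block_def)
    finally show ?thesis using i by simp
  qed
  then show ?thesis
    unfolding tr_def using bs_block_carrier[of N m] by (intro sum.cong) auto
qed

lemma tr_bs_block_mono:
  assumes "psd (tx_dim N) (A - B)" "A \<in> carrier_mat (tx_dim N) (tx_dim N)"
    "B \<in> carrier_mat (tx_dim N) (tx_dim N)"
  shows "Re (tr (bs_block N m * B)) \<le> Re (tr (bs_block N m * A))"
  using assms by (auto simp: tr_bs_block intro!: sum_mono psd_minus_diag_le)

lemma tr_outer_mult_outer: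
  assumes "w \<in> carrier_vec n" "h \<in> carrier_vec n"
  shows "Re (tr (outer w * outer h)) = (cmod (w \<bullet>c h))\<^sup>2"
  using assms by (simp add: tr_mult_outer[where n = n] outer_form[where n = n])

section \<open>Rate constraints of R0 as constraints of R1 on rank-one matrices\<close>

lemma valid_networkD:
  assumes "valid_network N"
  shows "finite (requests N)" "0 < noise N" "0 < noise_eve N"
    "chan_eve N \<in> carrier_mat (tx_dim N) (num_eve_ant N)"
    and "\<rho> \<in> requests N \<Longrightarrow> chan N \<rho> \<in> carrier_vec (tx_dim N)"
    and "\<rho> \<in> requests N \<Longrightarrow> 0 < kappa_req N \<rho>"
    and "\<rho> \<in> requests N \<Longrightarrow> 0 \<le> kappa_tol N \<rho>"
proof -
  show "finite (requests N)"
    by (rule finite_subset[of _ "{1..num_rx N} \<times> {1..num_files N} \<times> {1..num_subfiles N}"])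
      (use assms in \<open>auto simp: valid_network_def\<close>)
  show "0 < kappa_req N \<rho>" if "\<rho> \<in> requests N"
    using assms that unfolding valid_network_def kappa_req_def by (simp add: gr_one_powr)
  show "0 \<le> kappa_tol N \<rho>" if "\<rho> \<in> requests N"
    using assms that unfolding valid_network_def kappa_tol_def by (simp add: ge_one_powr_ge_zero)
qed (use assms in \<open>auto simp: valid_network_def\<close>)

text \<open>The logarithm is increasing, and both \<open>kappa_req\<close> and noise plus
  interference are positive, so exponentiating and clearing fractions are equivalences.\<close>

lemma rate_req_iff:
  assumes N: "valid_network N" and w: "\<And>\<rho>. \<rho> \<in> requests N \<Longrightarrow> w \<rho> \<in> carrier_vec (tx_dim N)"
    and \<rho>: "\<rho> \<in> requests N"
  shows "rate N w \<rho> \<ge> rate_req N \<rho> \<longleftrightarrow>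
    1 / kappa_req N \<rho> * Re (tr (outer (w \<rho>) * chan_mat N \<rho>)) \<ge>
      noise N + (\<Sum>\<rho>'\<in>requests N - {\<rho>}. Re (tr (outer (w \<rho>') * chan_mat N \<rho>)))"
proof -
  define a where "a = (cmod (w \<rho> \<bullet>c chan N \<rho>))\<^sup>2"
  define S where "S = (\<Sum>\<rho>'\<in>requests N - {\<rho>}. (cmod (w \<rho>' \<bullet>c chan N \<rho>))\<^sup>2)"
  have h: "chan N \<rho> \<in> carrier_vec (tx_dim N)" by (rule valid_networkD(5)[OF N \<rho>])
  note pos = valid_networkD(2)[OF N] valid_networkD(6)[OF N \<rho>]
  have a0: "0 \<le> a" and S0: "0 \<le> S" by (auto simp: a_def S_def intro: sum_nonneg)
  have a: "Re (tr (outer (w \<rho>) * chan_mat N \<rho>)) = a"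
    unfolding a_def chan_mat_def using w[OF \<rho>] h by (rule tr_outer_mult_outer)
  have S: "(\<Sum>\<rho>'\<in>requests N - {\<rho>}. Re (tr (outer (w \<rho>') * chan_mat N \<rho>))) = S"
    unfolding S_def chan_mat_def using w h by (intro sum.cong) (auto intro: tr_outer_mult_outer)
  \<comment> \<open>Numerator and denominator are multiplied by the noise variance.\<close>
  have sinr: "sinr N w \<rho> = a / (noise N + S)"
    unfolding sinr_def a_def[symmetric] S_def[symmetric] using pos S0 by (simp add: field_simps)
  have s0: "0 \<le> sinr N w \<rho>" unfolding sinr using a0 S0 pos by simp
  have "rate N w \<rho> \<ge> rate_req N \<rho> \<longleftrightarrow> kappa_req N \<rho> \<le> sinr N w \<rho>"
    unfolding rate_def kappa_req_def using s0 by (subst le_log_iff) auto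
  also have "\<dots> \<longleftrightarrow> kappa_req N \<rho> * (noise N + S) \<le> a"
    unfolding sinr using pos S0 by (simp add: pos_le_divide_eq)
  also have "\<dots> \<longleftrightarrow> noise N + S \<le> 1 / kappa_req N \<rho> * a"
    using pos by (simp add: pos_le_divide_eq mult.commute)
  finally show ?thesis unfolding a S .
qed

text \<open>With \<open>u = G^H w\<close> both sides say
  \<open>|u|^2 <= noise_eve * kappa_tol\<close>: the rate through the determinant of a rank-one
  update, the matrix inequality through the bound on \<open>u u^H\<close> by a multiple of the
  identity.\<close>

lemma rate_tol_iff:
  assumes N: "valid_network N" and w: "w \<rho> \<in> carrier_vec (tx_dim N)" and \<rho>: "\<rho> \<in> requests N"
  shows "rate_eve N w \<rho> \<le> rate_tol N \<rho> \<longleftrightarrow>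
    loewner_le (num_eve_ant N) (mat_adjoint (chan_eve N) * outer (w \<rho>) * chan_eve N)
      (complex_of_real (noise_eve N * kappa_tol N \<rho>) \<cdot>\<^sub>m 1\<^sub>m (num_eve_ant N))"
proof -
  let ?n = "num_eve_ant N"
  define u where "u = mat_adjoint (chan_eve N) *\<^sub>v w \<rho>"
  note G = valid_networkD(4)[OF N] and pos = valid_networkD(3)[OF N] valid_networkD(7)[OF N \<rho>]
  have u: "u \<in> carrier_vec ?n"
    unfolding u_def by (rule mult_mat_vec_carrier[OF mat_adjoint_carrier[OF G] w])
  have out: "mat_adjoint (chan_eve N) * outer (w \<rho>) * chan_eve N = outer u"
    unfolding u_def by (rule adjoint_outer_congruence[OF G w])
  have "Re (det (1\<^sub>m ?n + complex_of_real (1 / noise_eve N) \<cdot>\<^sub>m outer u)) = 1 + Re (u \<bullet>c u) / noise_eve N"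
    by (subst det_one_plus_outer[OF u]) (simp del: of_real_divide)
  then have "rate_eve N w \<rho> = log 2 (1 + Re (u \<bullet>c u) / noise_eve N)"
    unfolding rate_eve_def out by simp
  moreover have "0 < 1 + Re (u \<bullet>c u) / noise_eve N"
    using cscalar_self_nonneg[of u] pos by (simp add: add_pos_nonneg)
  ultimately have "rate_eve N w \<rho> \<le> rate_tol N \<rho> \<longleftrightarrow> Re (u \<bullet>c u) / noise_eve N \<le> kappa_tol N \<rho>"
    unfolding kappa_tol_def by (simp add: log_le_iff algebra_simps)
  also have "\<dots> \<longleftrightarrow> Re (u \<bullet>c u) \<le> noise_eve N * kappa_tol N \<rho>"
    using pos by (simp add: pos_divide_le_eq mult.commute)
  also have "\<dots> \<longleftrightarrow> psd ?n (complex_of_real (noise_eve N * kappa_tol N \<rho>) \<cdot>\<^sub>m 1\<^sub>m ?n - outer u)"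
    using pos by (subst psd_scaled_one_minus_outer[OF u]) auto
  finally show ?thesis unfolding loewner_le_def out using u by simp
qed

text \<open>The power constraints agree literally, the rate constraints through the two equivalences
  above, and outer products are semidefinite. This embeds R0 in R1 and brings rank-one points of R1
  back to R0.\<close>

lemma R0_feasible_iff:
  assumes N: "valid_network N"
  shows "R0_feasible N q w \<longleftrightarrow>
    (\<forall>\<rho>\<in>requests N. w \<rho> \<in> carrier_vec (tx_dim N)) \<and> R1_feasible N q (\<lambda>\<rho>. outer (w \<rho>))"
proof (cases "\<forall>\<rho>\<in>requests N. w \<rho> \<in> carrier_vec (tx_dim N)")
  case True
  then have "hermitian (tx_dim N) (outer (w \<rho>))" "psd (tx_dim N) (outer (w \<rho>))" if "\<rho> \<in> requests N" for \<rho>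
    using that psd_outer psdD(2) by blast+
  with True show ?thesis
    unfolding R0_feasible_def R1_feasible_def
    using rate_req_iff[OF N, of w] rate_tol_iff[OF N, of w] by simp
qed (unfold R0_feasible_def, blast)

lemma R0_objective_eq:
  assumes "\<And>\<rho>. \<rho> \<in> requests N \<Longrightarrow> w \<rho> \<in> carrier_vec (tx_dim N)"
  shows "R1_objective N (\<lambda>\<rho>. outer (w \<rho>)) = R0_objective N w"
  using assms unfolding R0_objective_def R1_objective_def by (subst tr_mat_sum) auto

section \<open>Comparison of R1 with R0: domination, objectives, optima\<close>

lemma R1_feasible_psd: "R1_feasible N q W \<Longrightarrow> \<rho> \<in> requests N \<Longrightarrow> psd (tx_dim N) (W \<rho>)"
  unfolding R1_feasible_def by blast

lemma R1_objective_eq: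
  assumes "\<And>\<rho>. \<rho> \<in> requests N \<Longrightarrow> W \<rho> \<in> carrier_mat (tx_dim N) (tx_dim N)"
  shows "R1_objective N W = (\<Sum>\<rho>\<in>requests N. Re (tr (W \<rho>)))"
  using assms unfolding R1_objective_def by (subst tr_mat_sum) auto

lemma tr_chan_mat_mono:
  assumes N: "valid_network N" and \<rho>: "\<rho> \<in> requests N" and AB: "psd (tx_dim N) (A - B)"
    and A: "A \<in> carrier_mat (tx_dim N) (tx_dim N)" and B: "B \<in> carrier_mat (tx_dim N) (tx_dim N)"
  shows "Re (tr (B * chan_mat N \<rho>)) \<le> Re (tr (A * chan_mat N \<rho>))"
  using psd_minus_form_le[OF AB A B valid_networkD(5)[OF N \<rho>]] valid_networkD(5)[OF N \<rho>] A B
  by (simp add: chan_mat_def tr_mult_outer[where n = "tx_dim N"])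

text \<open>(C6) bounds the scaled signal from below by positive noise plus interference, which
  semidefiniteness makes nonnegative. This supplies the normaliser of \<open>rank_one_part\<close>
  and later shows that optimal beamformers are nonzero.\<close>

lemma R1_signal_pos:
  assumes N: "valid_network N" and W: "R1_feasible N q W" and \<rho>: "\<rho> \<in> requests N"
  shows "0 < Re ((W \<rho> *\<^sub>v chan N \<rho>) \<bullet>c chan N \<rho>)"
proof -
  have h: "chan N \<rho> \<in> carrier_vec (tx_dim N)" by (rule valid_networkD(5)[OF N \<rho>])
  have tr: "tr (W \<rho>' * chan_mat N \<rho>) = (W \<rho>' *\<^sub>v chan N \<rho>) \<bullet>c chan N \<rho>" if "\<rho>' \<in> requests N" for \<rho>'
    unfolding chan_mat_def by (rule tr_mult_outer[OF psdD(1)[OF R1_feasible_psd[OF W that]] h])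
  have "0 \<le> (\<Sum>\<rho>'\<in>requests N - {\<rho>}. Re (tr (W \<rho>' * chan_mat N \<rho>)))"
    using tr psdD(3)[OF R1_feasible_psd[OF W] h] by (intro sum_nonneg) auto
  then have "0 < 1 / kappa_req N \<rho> * Re (tr (W \<rho> * chan_mat N \<rho>))"
    using W \<rho> valid_networkD(2)[OF N] unfolding R1_feasible_def by fastforce
  then show ?thesis using tr[OF \<rho>] valid_networkD(6)[OF N \<rho>] by (simp add: zero_less_divide_iff)
qed

text \<open>Descending in the Loewner order cannot raise power, interference or leakage. Only the
  useful signal could suffer, hence the assumption that it is preserved.\<close>

lemma R1_feasible_dominated:
  assumes N: "valid_network N" and W: "R1_feasible N q W"
    and W': "\<And>\<rho>. \<rho> \<in> requests N \<Longrightarrow> psd (tx_dim N) (W' \<rho>)"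
    and D: "\<And>\<rho>. \<rho> \<in> requests N \<Longrightarrow> psd (tx_dim N) (W \<rho> - W' \<rho>)"
    and signal: "\<And>\<rho>. \<rho> \<in> requests N \<Longrightarrow>
      Re (tr (W' \<rho> * chan_mat N \<rho>)) = Re (tr (W \<rho> * chan_mat N \<rho>))"
  shows "R1_feasible N q W'"
proof -
  let ?n = "tx_dim N"
  note C = psdD(1)[OF R1_feasible_psd[OF W]] and C' = psdD(1)[OF W']
  have block: "Re (tr (bs_block N m * W' \<rho>)) \<le> Re (tr (bs_block N m * W \<rho>))" if "\<rho> \<in> requests N" for m \<rho>
    by (rule tr_bs_block_mono[OF D[OF that] C[OF that] C'[OF that]])
  have C4: "Re (tr (bs_block N m * W' (k, f, l))) \<le> real (q f l m) * power_max N m"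
    if "m \<in> {1..num_bs N}" "(k, f, l) \<in> requests N" for m k f l
    using that W block[OF that(2), of m] unfolding R1_feasible_def by fastforce
  have C5: "Re (tr (mat_sum ?n (\<lambda>\<rho>. bs_block N m * W' \<rho>) (requests N))) \<le> power_max N m"
    if m: "m \<in> {1..num_bs N}" for m
  proof -
    have "Re (tr (mat_sum ?n (\<lambda>\<rho>. bs_block N m * W' \<rho>) (requests N))) =
        (\<Sum>\<rho>\<in>requests N. Re (tr (bs_block N m * W' \<rho>)))"
      using C' by (subst tr_mat_sum) (auto intro: mult_carrier_mat[OF bs_block_carrier])
    also have "\<dots> \<le> (\<Sum>\<rho>\<in>requests N. Re (tr (bs_block N m * W \<rho>)))"
      by (rule sum_mono[OF block])
    also have "\<dots> = Re (tr (mat_sum ?n (\<lambda>\<rho>. bs_block N m * W \<rho>) (requests N)))"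
      using C by (subst tr_mat_sum) (auto intro: mult_carrier_mat[OF bs_block_carrier])
    also have "\<dots> \<le> power_max N m" using W m unfolding R1_feasible_def by blast
    finally show ?thesis .
  qed
  have C6: "1 / kappa_req N \<rho> * Re (tr (W' \<rho> * chan_mat N \<rho>)) \<ge>
      noise N + (\<Sum>\<rho>'\<in>requests N - {\<rho>}. Re (tr (W' \<rho>' * chan_mat N \<rho>)))"
    if \<rho>: "\<rho> \<in> requests N" for \<rho>
  proof -
    \<comment> \<open>Interference consists of the forms of the other matrices at the channel
      vector, hence is monotone.\<close>
    have "noise N + (\<Sum>\<rho>'\<in>requests N - {\<rho>}. Re (tr (W' \<rho>' * chan_mat N \<rho>)))
        \<le> noise N + (\<Sum>\<rho>'\<in>requests N - {\<rho>}. Re (tr (W \<rho>' * chan_mat N \<rho>)))"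
      using tr_chan_mat_mono[OF N \<rho> D C C'] by (intro add_left_mono sum_mono) auto
    also have "\<dots> \<le> 1 / kappa_req N \<rho> * Re (tr (W \<rho> * chan_mat N \<rho>))"
      using W \<rho> unfolding R1_feasible_def by blast
    finally show ?thesis unfolding signal[OF \<rho>] .
  qed
  have C7: "loewner_le (num_eve_ant N) (mat_adjoint (chan_eve N) * W' \<rho> * chan_eve N)
      (complex_of_real (noise_eve N * kappa_tol N \<rho>) \<cdot>\<^sub>m 1\<^sub>m (num_eve_ant N))" (is "loewner_le ?k _ ?I")
    if \<rho>: "\<rho> \<in> requests N" for \<rho>
  proof -
    let ?G = "chan_eve N"
    let ?H = "mat_adjoint ?G"
    note G = valid_networkD(4)[OF N]
    note H = mat_adjoint_carrier[OF G]
    \<comment> \<open>Congruence is linear, so the difference of the leakage matrices is the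
      congruence of a semidefinite difference; transitivity of the order then applies.\<close>
    have "?H * (W \<rho> - W' \<rho>) * ?G = ?H * W \<rho> * ?G - ?H * W' \<rho> * ?G"
      using mult_minus_distrib_mat[OF H C[OF \<rho>] C'[OF \<rho>]]
        minus_mult_distrib_mat[OF mult_carrier_mat[OF H C[OF \<rho>]] mult_carrier_mat[OF H C'[OF \<rho>]] G] by simp
    then have step: "psd ?k (?H * W \<rho> * ?G - ?H * W' \<rho> * ?G)"
      using psd_congruence[OF D[OF \<rho>] G] by simp
    have le: "loewner_le ?k (?H * W \<rho> * ?G) ?I"
      using W \<rho> unfolding R1_feasible_def by blast
    have herm: "hermitian ?k (?H * W' \<rho> * ?G)"
      by (rule hermitian_congruence[OF psdD(2)[OF W'[OF \<rho>]] G])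
    have "psd ?k (?I - ?H * W' \<rho> * ?G)"
      by (rule psd_minus_trans[OF hermitian_scaled_one _ herm _ step]) (use le in \<open>auto simp: loewner_le_def\<close>)
    then show ?thesis unfolding loewner_le_def using hermitianD(1)[OF herm] by simp
  qed
  show ?thesis
    unfolding R1_feasible_def using C4 C5 C6 C7 W' psdD(2)[OF W'] by blast
qed

text \<open>Each matrix is reduced along its own channel vector, the direction in which (C6) needs
  the form to keep its value.\<close>

lemma R1_reduction:
  assumes N: "valid_network N" and W: "R1_feasible N q W"
  shows "\<exists>w. R0_feasible N q w \<and> (\<forall>\<rho>\<in>requests N. psd (tx_dim N) (W \<rho> - outer (w \<rho>)))"
proof -
  let ?w = "\<lambda>\<rho>. rank_one_part (W \<rho>) (chan N \<rho>)"
  note r = rank_one_part[OF R1_feasible_psd[OF W] valid_networkD(5)[OF N] R1_signal_pos[OF N W]]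
  have "R1_feasible N q (\<lambda>\<rho>. outer (?w \<rho>))"
    by (rule R1_feasible_dominated[OF N W]) (auto intro: psd_outer r simp: chan_mat_def)
  then have "R0_feasible N q ?w" using r(1) by (simp add: R0_feasible_iff[OF N])
  then show ?thesis using r(2) by blast
qed

text \<open>By linearity of the trace, the gap between the objectives is a sum of traces of
  semidefinite differences. Its nonnegativity compares the optimal values; its vanishing forces
  equality at an optimum.\<close>

lemma R1_objective_split:
  assumes W: "R1_feasible N q W" and w: "R0_feasible N q w"
    and D: "\<And>\<rho>. \<rho> \<in> requests N \<Longrightarrow> psd (tx_dim N) (W \<rho> - outer (w \<rho>))"
  shows "R0_objective N w + (\<Sum>\<rho>\<in>requests N. Re (tr (W \<rho> - outer (w \<rho>)))) = R1_objective N W"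
    and "\<rho> \<in> requests N \<Longrightarrow> 0 \<le> Re (tr (W \<rho> - outer (w \<rho>)))"
proof -
  have C: "W \<rho> \<in> carrier_mat (tx_dim N) (tx_dim N)" "w \<rho> \<in> carrier_vec (tx_dim N)"
    if "\<rho> \<in> requests N" for \<rho>
    using psdD(1)[OF R1_feasible_psd[OF W that]] w that by (auto simp: R0_feasible_def)
  have "Re (tr (W \<rho>)) = Re (tr (outer (w \<rho>))) + Re (tr (W \<rho> - outer (w \<rho>)))" if "\<rho> \<in> requests N" for \<rho>
    using C[OF that] by (simp add: tr_def sum_subtractf carrier_vecD)
  then show "R0_objective N w + (\<Sum>\<rho>\<in>requests N. Re (tr (W \<rho> - outer (w \<rho>)))) = R1_objective N W"
    using C(1) by (simp add: R1_objective_eq R0_objective_def sum.distrib)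
  show "0 \<le> Re (tr (W \<rho> - outer (w \<rho>)))" if "\<rho> \<in> requests N"
    using psd_diag_nonneg[OF D[OF that]] psdD(1)[OF D[OF that]]
    by (auto simp: tr_def intro!: sum_nonneg)
qed

text \<open>Optimality leaves no gap to the reduced point, so every difference has trace zero and
  vanishes. Nonzero vectors are recorded because the zero matrix is not the outer product of a
  positively scaled eigenvector.\<close>

lemma R1_optimal_is_outer:
  assumes N: "valid_network N" and W: "optimal_solution (R1_feasible N q) (R1_objective N) W"
  shows "\<exists>w. R0_feasible N q w \<and> (\<forall>\<rho>\<in>requests N. W \<rho> = outer (w \<rho>) \<and> w \<rho> \<noteq> 0\<^sub>v (tx_dim N))"
proof -
  let ?n = "tx_dim N"
  have feas: "R1_feasible N q W" and opt: "\<And>V. R1_feasible N q V \<Longrightarrow> R1_objective N W \<le> R1_objective N V"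
    using W by (auto simp: optimal_solution_def)
  obtain w where w: "R0_feasible N q w" and D: "\<And>\<rho>. \<rho> \<in> requests N \<Longrightarrow> psd ?n (W \<rho> - outer (w \<rho>))"
    using R1_reduction[OF N feas] by blast
  have C: "w \<rho> \<in> carrier_vec ?n" if "\<rho> \<in> requests N" for \<rho>
    using w that by (auto simp: R0_feasible_def)
  note obj = R1_objective_split[OF feas w D]
  \<comment> \<open>The family of outer products is feasible for R1 and thus competes with
    \<open>W\<close>.\<close>
  have "R1_objective N W \<le> R0_objective N w"
    using opt[of "\<lambda>\<rho>. outer (w \<rho>)"] w R0_feasible_iff[OF N] R0_objective_eq[of N w] C by auto
  then have "(\<Sum>\<rho>\<in>requests N. Re (tr (W \<rho> - outer (w \<rho>)))) \<le> 0" using obj(1) by simp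
  then have "(\<Sum>\<rho>\<in>requests N. Re (tr (W \<rho> - outer (w \<rho>)))) = 0"
    using sum_nonneg[of "requests N" "\<lambda>\<rho>. Re (tr (W \<rho> - outer (w \<rho>)))"] obj(2) by fastforce
  then have tr0: "Re (tr (W \<rho> - outer (w \<rho>))) \<le> 0" if "\<rho> \<in> requests N" for \<rho>
    using that obj(2) valid_networkD(1)[OF N] by (subst (asm) sum_nonneg_eq_0_iff) auto
  have eq: "W \<rho> = outer (w \<rho>)" if \<rho>: "\<rho> \<in> requests N" for \<rho>
  proof (rule eq_matI)
    note Z = psd_trace_zero[OF D[OF \<rho>] tr0[OF \<rho>]] and CW = psdD(1)[OF R1_feasible_psd[OF feas \<rho>]]
    fix i j assume "i < dim_row (outer (w \<rho>))" "j < dim_col (outer (w \<rho>))"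
    then have "i < ?n" "j < ?n" using C[OF \<rho>] by auto
    then show "W \<rho> $$ (i, j) = outer (w \<rho>) $$ (i, j)"
      using arg_cong[OF Z, of "\<lambda>A. A $$ (i, j)"] CW C[OF \<rho>] by simp
  qed (use C[OF \<rho>] psdD(1)[OF R1_feasible_psd[OF feas \<rho>]] in auto)
  \<comment> \<open>A zero vector would give zero useful signal.\<close>
  have "w \<rho> \<noteq> 0\<^sub>v ?n" if \<rho>: "\<rho> \<in> requests N" for \<rho>
    using R1_signal_pos[OF N feas \<rho>] outer_form[OF C[OF \<rho>] valid_networkD(5)[OF N \<rho>]] eq[OF \<rho>]
      valid_networkD(5)[OF N \<rho>] by auto
  with w eq show ?thesis by blast
qed

theorem theorem1:
  fixes N :: network and q :: "nat \<Rightarrow> nat \<Rightarrow> nat \<Rightarrow> nat"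
  assumes "valid_network N"
    and "\<And>f l m. f \<in> {1..num_files N} \<Longrightarrow> l \<in> {1..num_subfiles N} \<Longrightarrow> m \<in> {1..num_bs N} \<Longrightarrow>
           q f l m \<in> {0, 1}"
  shows "optimal_value (R0_feasible N q) (R0_objective N) =
           optimal_value (R1_feasible N q) (R1_objective N) \<and>
         (\<forall>W. optimal_solution (R1_feasible N q) (R1_objective N) W \<longrightarrow>
            (\<forall>\<rho>\<in>requests N. vec_space.rank (tx_dim N) (W \<rho>) \<le> 1) \<and>
            (\<forall>\<rho>\<in>requests N. \<exists>v. principal_eigenvector (W \<rho>) v) \<and>
            (\<forall>\<rho>\<in>requests N. \<forall>v. principal_eigenvector (W \<rho>) v \<longrightarrow>
               (\<exists>c>0. outer (complex_of_real c \<cdot>\<^sub>v v) = W \<rho>)) \<and>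
            (\<forall>w. (\<forall>\<rho>\<in>requests N. principal_eigenvector (W \<rho>) (w \<rho>) \<and>
                    outer (w \<rho>) = W \<rho>) \<longrightarrow>
               optimal_solution (R0_feasible N q) (R0_objective N) w))"
proof (intro conjI allI impI)
  let ?n = "tx_dim N"
  note N = assms(1)
  have lift: "R1_feasible N q (\<lambda>\<rho>. outer (w \<rho>))" "R1_objective N (\<lambda>\<rho>. outer (w \<rho>)) = R0_objective N w"
    if "R0_feasible N q w" for w
    using that R0_feasible_iff[OF N] R0_objective_eq by blast+
  show "optimal_value (R0_feasible N q) (R0_objective N) = optimal_value (R1_feasible N q) (R1_objective N)"
    unfolding optimal_value_def
  \<comment> \<open>Infeasibility needs no separate case: every feasible point of one problem yields
    one of the other that costs no more, and the infimum over the empty set is the top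
    element.\<close>
  proof (rule antisym; rule INF_greatest)
    fix W assume "W \<in> {W. R1_feasible N q W}"
    then have W: "R1_feasible N q W" by simp
    then obtain w where w: "R0_feasible N q w" and D: "\<And>\<rho>. \<rho> \<in> requests N \<Longrightarrow> psd ?n (W \<rho> - outer (w \<rho>))"
      using R1_reduction[OF N] by blast
    have "R0_objective N w \<le> R1_objective N W"
      using R1_objective_split[OF W w D] sum_nonneg[of "requests N" "\<lambda>\<rho>. Re (tr (W \<rho> - outer (w \<rho>)))"]
      by fastforce
    then show "(INF w\<in>{w. R0_feasible N q w}. ereal (R0_objective N w)) \<le> ereal (R1_objective N W)"
      using w by (intro INF_lower2[of w]) auto
  next
    fix w assume "w \<in> {w. R0_feasible N q w}"
    then show "(INF W\<in>{W. R1_feasible N q W}. ereal (R1_objective N W)) \<le> ereal (R0_objective N w)"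
      using lift[of w] by (intro INF_lower2[of "\<lambda>\<rho>. outer (w \<rho>)"]) auto
  qed
  fix W assume opt: "optimal_solution (R1_feasible N q) (R1_objective N) W"
  obtain u where u: "R0_feasible N q u"
    and Wu: "\<And>\<rho>. \<rho> \<in> requests N \<Longrightarrow> W \<rho> = outer (u \<rho>)" "\<And>\<rho>. \<rho> \<in> requests N \<Longrightarrow> u \<rho> \<noteq> 0\<^sub>v ?n"
    using R1_optimal_is_outer[OF N opt] by blast
  have C: "u \<rho> \<in> carrier_vec ?n" if "\<rho> \<in> requests N" for \<rho>
    using u that by (auto simp: R0_feasible_def)
  show "\<forall>\<rho>\<in>requests N. vec_space.rank ?n (W \<rho>) \<le> 1"
    using Wu(1) rank_outer_le_1[OF C] by simp
  show "\<forall>\<rho>\<in>requests N. \<exists>v. principal_eigenvector (W \<rho>) v"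
    using Wu principal_eigenvector_outer_self[OF C] by fastforce
  show "\<forall>\<rho>\<in>requests N. \<forall>v. principal_eigenvector (W \<rho>) v \<longrightarrow>
      (\<exists>c>0. outer (complex_of_real c \<cdot>\<^sub>v v) = W \<rho>)"
    using Wu principal_eigenvector_outer_scaled[OF C] by simp
  \<comment> \<open>This \<open>w\<close> may differ from \<open>u\<close> by a phase at each
    request, so its feasibility is derived from its outer products.\<close>
  fix w assume w: "\<forall>\<rho>\<in>requests N. principal_eigenvector (W \<rho>) (w \<rho>) \<and> outer (w \<rho>) = W \<rho>"
  have dim: "w \<rho> \<in> carrier_vec ?n" if "\<rho> \<in> requests N" for \<rho>
    using w that Wu(1)[OF that] C[OF that]
    by (auto simp: principal_eigenvector_def eigenvector_def carrier_vecD)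
  have W: "R1_feasible N q W" and opt': "\<And>V. R1_feasible N q V \<Longrightarrow> R1_objective N W \<le> R1_objective N V"
    using opt by (auto simp: optimal_solution_def)
  note P = R1_feasible_psd[OF W]
  \<comment> \<open>\<open>W\<close> and the family of outer products are known to agree on the
    requests only and cannot be identified as functions; domination with zero differences transfers
    feasibility.\<close>
  have "R1_feasible N q (\<lambda>\<rho>. outer (w \<rho>))"
    by (rule R1_feasible_dominated[OF N W]) (use w P psd_minus_self[OF P] in auto)
  then have wf: "R0_feasible N q w" using dim by (simp add: R0_feasible_iff[OF N])
  have "R0_objective N w = R1_objective N W"
    using w psdD(1)[OF P] by (simp add: R0_objective_def R1_objective_eq)
  then show "optimal_solution (R0_feasible N q) (R0_objective N) w"
    unfolding optimal_solution_def using wf opt' lift by metis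
qed

end
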